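(* Let $k,n$ be positive integers with $n\ge 6$, $k\le n/2$, and $$\frac{2^n}{n+1}<\binom nk\le \frac{2^n}n.$$ Then $k=f(n)$, where $f(n)$ is the least positive integer $r$ such that $\binom nr>\frac{2^n}{n+1}$.
   Context: For an integer $n\ge 3$, $f(n)$ denotes the least positive integer $r$ such that $\binom nr>\frac{2^n}{n+1}$. *)

theory Defs
  imports Complex_Main
begin

text \<open>The mathematical definition is for \<open>n \<ge> 3\<close>, where such an \<open>r\<close> always exists.\<close>

definition f :: "nat \<Rightarrow> nat" where
  "f n = (LEAST r. 0 < r \<and> real (n choose r) > 2 ^ n / (real n + 1))"

end

theory Submission
  imports Defs
begin

text \<open>Below the middle the binomial coefficients grow by a factor of at least \<open>(n + 2) / n\<close> per
  step. The interval \<open>(2 ^ n / (n + 1), 2 ^ n / n]\<close> only spans a factor of \<open>(n + 1) / n\<close>, so all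
  coefficients preceding one that lies in it are at most \<open>2 ^ n / (n + 1)\<close>.\<close>

lemma Suc_times_binomial_Suc: "Suc j * (n choose Suc j) = (n - j) * (n choose j)"
  by (simp only: binomial_absorption binomial_absorb_comp)

lemma binomial_Suc_growth_below_middle:
  fixes j n :: nat
  assumes "2 * Suc j \<le> n"
  shows "(n + 2) * (n choose j) \<le> n * (n choose Suc j)"
proof -
  have "n + 2 \<le> 2 * (n - j)"
    using assms by simp
  then have "Suc j * ((n + 2) * (n choose j)) \<le> Suc j * (2 * (n - j) * (n choose j))"
    by (intro mult_le_mono2 mult_le_mono1)
  also have "\<dots> = 2 * Suc j * (Suc j * (n choose Suc j))"
    by (simp only: Suc_times_binomial_Suc mult_ac)
  also have "\<dots> \<le> n * (Suc j * (n choose Suc j))"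
    using assms by (rule mult_le_mono1)
  also have "\<dots> = Suc j * (n * (n choose Suc j))"
    by (rule mult.left_commute)
  finally show ?thesis
    by (simp only: Suc_mult_le_cancel1)
qed

lemma binomial_growth_below_middle:
  fixes k n r :: nat
  assumes "r < k" and "2 * k \<le> n"
  shows "(n + 2) * (n choose r) \<le> n * (n choose k)"
proof -
  obtain j where "k = Suc j" and "r \<le> j"
    using \<open>r < k\<close> by (cases k) auto
  have "n choose r \<le> n choose j"
    using \<open>r \<le> j\<close> \<open>2 * k \<le> n\<close> \<open>k = Suc j\<close> by (intro binomial_mono) simp_all
  then have "(n + 2) * (n choose r) \<le> (n + 2) * (n choose j)"
    by (rule mult_le_mono2)
  also have "\<dots> \<le> n * (n choose k)"
    using binomial_Suc_growth_below_middle \<open>2 * k \<le> n\<close> \<open>k = Suc j\<close> by simp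
  finally show ?thesis .
qed

theorem theorem2p5:
  fixes k n :: nat
  assumes "0 < k" and "0 < n" and "n \<ge> 6" and "real k \<le> real n / 2"
    and "2 ^ n / (real n + 1) < real (n choose k)"
    and "real (n choose k) \<le> 2 ^ n / real n"
  shows "k = f n"
proof -
  have "2 * k \<le> n"
    using assms(4) by linarith
  have "k \<le> r" if "2 ^ n / (real n + 1) < real (n choose r)" for r
  proof (rule ccontr)
    assume "\<not> k \<le> r"
    then have "r < k" by simp
    have "2 ^ n < (real n + 1) * real (n choose r)"
      using that by (simp add: field_simps)
    also have "\<dots> \<le> real ((n + 2) * (n choose r))"
      by (simp add: algebra_simps)
    also have "\<dots> \<le> real (n * (n choose k))"
      using binomial_growth_below_middle \<open>r < k\<close> \<open>2 * k \<le> n\<close>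
      by (simp only: of_nat_le_iff)
    also have "\<dots> \<le> 2 ^ n"
      using assms(2,6) by (simp add: field_simps)
    finally show False by simp
  qed
  then show ?thesis
    unfolding f_def using assms(1,5) by (intro Least_equality[symmetric]) auto
qed

end
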